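(* Let $f$ and $g$ be as defined in the context, and assume that (i) $f(n,a)=f(n+1,a)$ for all $a,n\in\mathbb{N}^+$ with $n\ge\lceil\log_2 a\rceil+1$, and (ii) $g(n,m)=g(n+1,m)$ for all $m,n\in\mathbb{N}^+$ with $m\ge 2$ and $n\ge\lceil\log_2 m\rceil$. Then for every $m\in\mathbb{N}^+$ for which there exists $i\in\mathbb{N}^+$ with $\frac{2}{3}2^i\le m\le 2^i$, every union-closed family $\mathcal{F}$ (on any finite ground set $[n]$) with $\mathcal{S}(\mathcal{F})\ne\emptyset$ and $m(\mathcal{F})=m$ satisfies $a(\mathcal{F})\ge \frac{m}{2}$.
   Context: A family $\mathcal{F}$ on ground set $[n]=\{1,\dots,n\}$ is a collection $\mathcal{S}(\mathcal{F})$ of distinct subsets of $[n]$ (elements of $[n]$ may lie in no set); $m(\mathcal{F})=|\mathcal{S}(\mathcal{F})|$. It is union-closed if $S\cup T\in\mathcal{S}(\mathcal{F})$ whenever $S,T\in\mathcal{S}(\mathcal{F})$. For $e\in[n]$, $m_e(\mathcal{F})$ is the number of sets of $\mathcal{F}$ containing $e$, and $a(\mathcal{F})=\max_{e\in[n]}m_e(\mathcal{F})$. For $n,a\in\mathbb{N}^+$, $f(n,a)$ is the maximum of $m(\mathcal{F})$ over all union-closed families $\mathcal{F}$ on ground set $[n]$ with $\mathcal{S}(\mathcal{F})\neq\emptyset$ and $a(\mathcal{F})\le a$. For $n,m\in\mathbb{N}^+$ with $m\ge2$ and $m\le 2^n$, $g(n,m)$ is the minimum of $a(\mathcal{F})$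 over all union-closed families $\mathcal{F}$ on ground set $[n]$ with $m(\mathcal{F})=m$. *)

theory Defs
  imports Complex_Main
begin

text \<open>A family on the ground set \<open>{1..n}\<close> is a set of sets \<open>\<F> \<subseteq> Pow {1..n}\<close>. The ground set is not
  determined by \<open>\<F>\<close>, so \<open>n\<close> is passed explicitly.\<close>

definition family_on :: "nat \<Rightarrow> nat set set \<Rightarrow> bool" where
  "family_on n \<F> \<longleftrightarrow> \<F> \<subseteq> Pow {1..n}"

definition union_closed :: "nat set set \<Rightarrow> bool" where
  "union_closed \<F> \<longleftrightarrow> (\<forall>S\<in>\<F>. \<forall>T\<in>\<F>. S \<union> T \<in> \<F>)"

definition occurrences :: "nat set set \<Rightarrow> nat \<Rightarrow> nat" where
  "occurrences \<F> e = card {S \<in> \<F>. e \<in> S}"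

text \<open>Meaningful for \<open>n \<ge> 1\<close> only: for \<open>n = 0\<close> it is the unspecified maximum of the empty set.\<close>

definition max_occurrences :: "nat \<Rightarrow> nat set set \<Rightarrow> nat" where
  "max_occurrences n \<F> = Max (occurrences \<F> ` {1..n})"

text \<open>Both extrema below range over finite sets. They are attained for \<open>n, a \<ge> 1\<close> in the first case
  (\<open>{{}}\<close> qualifies) and for \<open>n \<ge> 1\<close> and \<open>2 \<le> m \<le> 2 ^ n\<close> in the second.\<close>

definition uc_f :: "nat \<Rightarrow> nat \<Rightarrow> nat" where
  "uc_f n a = Max {card \<F> | \<F>.
     family_on n \<F> \<and> union_closed \<F> \<and> \<F> \<noteq> {} \<and> max_occurrences n \<F> \<le> a}"

definition uc_g :: "nat \<Rightarrow> nat \<Rightarrow> nat" where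
  "uc_g n m = Min {max_occurrences n \<F> | \<F>.
     family_on n \<F> \<and> union_closed \<F> \<and> card \<F> = m}"

end

theory Submission
  imports Defs
begin

text \<open>By the stability of \<open>g\<close> it suffices to treat families of \<open>m\<close> sets on the ground set \<open>[i]\<close>,
  that is, families that miss \<open>r \<le> 2\<^sup>i / 3\<close> of the subsets. For these the average set size is at least
  \<open>i / 2\<close> (Balla, Bollobas, Eccles). Reimer's up-compression maps the family bijectively onto an
  up-set, enlarging each set \<open>A\<close> to a set \<open>A'\<close> such that the intervals \<open>[A, A']\<close> are disjoint. The
  total enlargement is therefore at most \<open>r\<close>. On the other hand, the complement of the up-set is a
  down-set of \<open>r\<close> sets, and edge isoperimetry in the cube shows that the up-set exceeds the average
  size \<open>i / 2\<close> by a total of at least \<open>r\<close>.\<close>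

section \<open>Edge isoperimetry for down-sets\<close>

text \<open>The sum of the binary digit sums of all \<open>k < n\<close>, which is the maximal number of edges that \<open>n\<close>
  vertices of a cube can span.\<close>

fun digit_total :: "nat \<Rightarrow> nat" where
  "digit_total n = (if n \<le> 1 then 0
     else digit_total (n div 2) + digit_total (n - n div 2) + n div 2)"

declare digit_total.simps [simp del]

lemma digit_total_0 [simp]: "digit_total 0 = 0"
  and digit_total_1 [simp]: "digit_total (Suc 0) = 0"
  by (simp_all add: digit_total.simps)

lemma digit_total_even: "digit_total (2 * k) = 2 * digit_total k + k"
proof (cases "k = 0")
  case False
  then show ?thesis by (subst digit_total.simps) (simp add: mult_2)
qed simp

lemma digit_total_odd: "digit_total (2 * k + 1) = digit_total k + digit_total (k + 1) + k"
proof (cases "k = 0")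
  case False
  have "2 * k + 1 - k = k + 1" "(2 * k + 1) div 2 = k" "\<not> 2 * k + 1 \<le> 1" using False by auto
  then show ?thesis by (subst digit_total.simps) simp
qed simp

text \<open>Models two parts of a cube, of sizes \<open>a \<le> b\<close> in opposite facets, joined
  by at most \<open>a\<close> edges. Each of \<open>a\<close> and \<open>b\<close> is cut into its
  two halves, and the halves are paired so that the pair sums are the two halves of
  \<open>a + b\<close>.\<close>

lemma digit_total_superadditive:
  "a \<le> b \<Longrightarrow> digit_total a + digit_total b + a \<le> digit_total (a + b)"
proof (induction "a + b" arbitrary: a b rule: less_induct)
  case less
  have IH: "digit_total x + digit_total y + x \<le> digit_total (x + y)"
    if "x + y < a + b" "x \<le> y" for x y using less.hyps that by blast
  obtain c where c: "a = 2 * c \<or> a = 2 * c + 1" by (metis evenE oddE)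
  obtain d where d: "b = 2 * d \<or> b = 2 * d + 1" by (metis evenE oddE)
  show ?case
  proof (cases "a = 0")
    case False
    consider "a = 2 * c" "b = 2 * d" | "a = 2 * c" "b = 2 * d + 1"
      | "a = 2 * c + 1" "b = 2 * d" | "a = 2 * c + 1" "b = 2 * d + 1" using c d by blast
    then show ?thesis
    proof cases
      case 1
      then show ?thesis
        using IH[of c d] digit_total_even[of c] digit_total_even[of d] digit_total_even[of "c + d"]
          False less.prems by auto
    next
      case 2
      then show ?thesis
        using IH[of c d] IH[of c "d + 1"] digit_total_even[of c] digit_total_odd[of d]
          digit_total_odd[of "c + d"] False less.prems by auto
    next
      case 3
      then show ?thesis
        using IH[of c d] IH[of "c + 1" d] digit_total_even[of d] digit_total_odd[of c]
          digit_total_odd[of "c + d"] False less.prems by auto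
    next
      case 4
      have sum: "a + b = 2 * (c + d + 1)" using 4 by simp
      show ?thesis
      \<comment> \<open>For \<open>c < d\<close> the pairs are \<open>(c, d + 1)\<close> and
        \<open>(c + 1, d)\<close>. For \<open>c = d\<close> the second is out of order, and both
        amount to \<open>(c, c + 1)\<close>.\<close>
      proof (cases "c = d")
        case True
        then have "digit_total c + digit_total (c + 1) + c \<le> digit_total (c + d + 1)"
          using IH[of c "c + 1"] 4 by (cases "c = 0") auto
        then show ?thesis
          unfolding sum digit_total_even using digit_total_odd[of c] 4 True by simp
      next
        case False
        then show ?thesis
          unfolding sum digit_total_even
          using IH[of c "d + 1"] IH[of "c + 1" d] digit_total_odd[of c] digit_total_odd[of d] 4
            less.prems by auto
      qed
    qed
  qed simp
qed

section \<open>Values at powers of two and the one-third bound\<close>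

lemma digit_total_power2: "2 * digit_total (2 ^ k) = k * 2 ^ k"
  by (induction k) (simp_all add: digit_total_even algebra_simps)

text \<open>The \<open>r\<close> numbers starting at \<open>2 ^ k\<close> have the digits of the
  numbers below \<open>r\<close> and one leading 1 each, so superadditivity is sharp here.\<close>

lemma digit_total_power2_add:
  "r \<le> 2 ^ k \<Longrightarrow> digit_total (2 ^ k + r) = digit_total (2 ^ k) + digit_total r + r"
proof (induction k arbitrary: r)
  case 0
  then have "r = 0 \<or> r = 1" by auto
  then show ?case using digit_total_even[of 1] by (auto simp: numeral_2_eq_2)
next
  case (Suc k)
  show ?case
  proof (cases "even r")
    case True
    then obtain t where "r = 2 * t" by blast
    then show ?thesis
      using Suc.IH[of t] Suc.prems digit_total_even[of t] digit_total_even[of "2 ^ k"]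
        digit_total_even[of "2 ^ k + t"] by (simp add: algebra_simps)
  next
    case False
    then obtain t where r: "r = 2 * t + 1" by (elim oddE)
    moreover have "t + 1 \<le> 2 ^ k" using Suc.prems r by simp
    ultimately show ?thesis
      using Suc.IH[of t] Suc.IH[of "t + 1"] digit_total_odd[of t] digit_total_even[of "2 ^ k"]
        digit_total_odd[of "2 ^ k + t"] by (simp add: algebra_simps)
  qed
qed

text \<open>Splitting off the leading power, \<open>s = 2 ^ k + r\<close>, leaves the inequality
  \<open>r \<le> 2 ^ k\<close>: the \<open>r\<close> leading ones are at most half of all leading
  digits.\<close>

lemma digit_total_le: "s \<le> 2 ^ k \<Longrightarrow> 2 * digit_total s \<le> k * s"
proof (induction k arbitrary: s)
  case 0
  then have "s = 0 \<or> s = 1" by auto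
  then show ?case by auto
next
  case (Suc k)
  show ?case
  proof (cases "s \<le> 2 ^ k")
    case True
    then show ?thesis using Suc.IH[of s] by simp
  next
    case False
    then obtain r where r: "s = 2 ^ k + r" by (metis le_Suc_ex nat_le_linear)
    then have "r \<le> 2 ^ k" using Suc.prems by simp
    then show ?thesis
      using Suc.IH[of r] digit_total_power2_add[of r k] digit_total_power2[of k] r
      by (simp add: algebra_simps)
  qed
qed

text \<open>One third is 0.010101... in binary, so the claim reproduces itself when two binary
  places are removed. Together with the next lemma it puts a down-set of \<open>s\<close> sets at
  least \<open>s\<close> below the balanced total \<open>n * s / 2\<close>.\<close>

lemma digit_total_le_third: "3 * s \<le> 2 ^ n \<Longrightarrow> 2 * digit_total s + 2 * s \<le> n * s"
proof (induction n arbitrary: s rule: less_induct)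
  case (less n)
  consider "n \<le> 1" | k where "n = k + 2"
    by (metis Suc_1 add.commute le_Suc_ex not_less_eq_eq)
  then show ?case
  proof cases
    case 1
    then have "n = 0 \<or> n = 1" by linarith
    then have "s = 0" using less.prems by auto
    then show ?thesis by simp
  next
    case 2
    show ?thesis
    proof (cases "s \<le> 2 ^ k")
      case True
      then show ?thesis using digit_total_le[of s k] 2 by simp
    next
      case False
      then obtain r where r: "s = 2 ^ k + r" by (metis le_Suc_ex nat_le_linear)
      \<comment> \<open>From \<open>3 * (2 ^ k + r) \<le> 4 * 2 ^ k\<close>; the part
        \<open>2 ^ k\<close> of \<open>s\<close> contributes equally to both sides of the goal,
        leaving the claim for \<open>r\<close> and \<open>k\<close>.\<close>
      then have "3 * r \<le> 2 ^ k" using less.prems 2 by simp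
      then show ?thesis
        using less.IH[of k r] digit_total_power2_add[of r k] digit_total_power2[of k] r 2
        by (simp add: algebra_simps)
    qed
  qed
qed

text \<open>In a down-set, \<open>card A\<close> counts the edges going down from \<open>A\<close>,
  so the sum counts all spanned edges. Splitting along \<open>x\<close> gives two down-sets
  \<open>D1 \<subseteq> D0\<close> with \<open>card D1\<close> edges between them, which is the
  shape of superadditivity.\<close>

lemma down_set_total_size:
  fixes \<D> :: "'a set set"
  assumes "finite V" "\<D> \<subseteq> Pow V" "\<And>A B. A \<in> \<D> \<Longrightarrow> B \<subseteq> A \<Longrightarrow> B \<in> \<D>"
  shows "(\<Sum>A\<in>\<D>. card A) \<le> digit_total (card \<D>)"
  using assms
proof (induction V arbitrary: \<D> rule: finite_induct)
  case empty
  then show ?case by (auto simp: subset_singleton_iff)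
next
  case (insert x V)
  define D0 where "D0 = {A \<in> \<D>. x \<notin> A}"
  define D1 where "D1 = {A. x \<notin> A \<and> insert x A \<in> \<D>}"
  have fin: "finite \<D>"
    using insert.prems insert.hyps by (meson finite.insertI finite_Pow_iff finite_subset)
  have sub: "D1 \<subseteq> D0" unfolding D0_def D1_def using insert.prems(2) by blast
  have D0: "D0 \<subseteq> Pow V" unfolding D0_def using insert.prems by auto
  have split: "\<D> = D0 \<union> insert x ` D1"
  proof (intro equalityI subsetI)
    fix A assume A: "A \<in> \<D>"
    show "A \<in> D0 \<union> insert x ` D1"
    proof (cases "x \<in> A")
      case True
      then have "A = insert x (A - {x})" by blast
      then show ?thesis using A by (auto simp: D1_def intro: image_eqI[of _ _ "A - {x}"])
    qed (use A in \<open>simp add: D0_def\<close>)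
  qed (auto simp: D0_def D1_def)
  have disj: "D0 \<inter> insert x ` D1 = {}" unfolding D0_def by auto
  have inj: "inj_on (insert x) D1" unfolding D1_def by (auto simp: inj_on_def)
  have finD: "finite D0" "finite D1" using fin finite_subset[OF sub] by (auto simp: D0_def)
  have card: "card \<D> = card D1 + card D0"
    unfolding split using disj inj finD by (subst card_Un_disjoint) (auto simp: card_image)
  have "(\<Sum>A\<in>\<D>. card A) = (\<Sum>A\<in>D0. card A) + (\<Sum>A\<in>D1. card (insert x A))"
    unfolding split using disj inj finD by (subst sum.union_disjoint) (auto simp: sum.reindex)
  also have "(\<Sum>A\<in>D1. card (insert x A)) = (\<Sum>A\<in>D1. card A) + card D1"
  proof -
    have "card (insert x A) = card A + 1" if "A \<in> D1" for A
      using that sub D0 \<open>finite V\<close> by (subst card_insert_disjoint) (auto simp: D1_def intro: finite_subset)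
    then show ?thesis by (simp add: sum.distrib sum_Suc)
  qed
  also have "(\<Sum>A\<in>D0. card A) \<le> digit_total (card D0)"
    by (rule insert.IH[OF D0]) (use insert.prems(2) in \<open>auto simp: D0_def\<close>)
  also have "(\<Sum>A\<in>D1. card A) \<le> digit_total (card D1)"
  proof (rule insert.IH)
    fix A B assume "A \<in> D1" "B \<subseteq> A"
    then show "B \<in> D1" using insert.prems(2)[of "insert x A" "insert x B"] by (auto simp: D1_def)
  qed (use sub D0 in blast)
  finally show ?case
    using digit_total_superadditive[OF card_mono[OF finD(1) sub]] card by simp
qed

section \<open>Up-compression of union-closed families\<close>

text \<open>A single step of Reimer's compression. The family is a parameter because
  \<open>A\<close> moves only if the place above it is free; a member that contains \<open>i\<close>
  is fixed.\<close>

definition lift :: "nat \<Rightarrow> nat set set \<Rightarrow> nat set \<Rightarrow> nat set" where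
  "lift i \<F> A = (if insert i A \<in> \<F> then A else insert i A)"

text \<open>Consider a pair of sets that differ only in \<open>i\<close>. If one of them is in the
  family, the lifted family holds the upper one; if both are, both remain.\<close>

lemma mem_lift_image:
  "B \<in> lift i \<F> ` \<F> \<longleftrightarrow>
     (if i \<in> B then B \<in> \<F> \<or> B - {i} \<in> \<F> else B \<in> \<F> \<and> insert i B \<in> \<F>)"
proof (cases "i \<in> B")
  case True
  show ?thesis
  proof
    assume "B \<in> lift i \<F> ` \<F>"
    then obtain A where A: "A \<in> \<F>" "B = lift i \<F> A" by blast
    show "if i \<in> B then B \<in> \<F> \<or> B - {i} \<in> \<F> else B \<in> \<F> \<and> insert i B \<in> \<F>"
      using A True by (cases "i \<in> A") (auto simp: lift_def insert_absorb split: if_splits)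
  next
    assume "if i \<in> B then B \<in> \<F> \<or> B - {i} \<in> \<F> else B \<in> \<F> \<and> insert i B \<in> \<F>"
    moreover have "lift i \<F> B = B" if "B \<in> \<F>" using that True by (simp add: lift_def insert_absorb)
    moreover have "lift i \<F> (B - {i}) = B" if "B \<notin> \<F>"
      using that True by (simp add: lift_def insert_absorb)
    ultimately show "B \<in> lift i \<F> ` \<F>" using True by (metis image_eqI)
  qed
next
  case False
  then show ?thesis unfolding lift_def image_iff by (auto split: if_splits)
qed

lemma inj_on_lift: "inj_on (lift i \<F>) \<F>"
proof (rule inj_onI)
  fix A B assume "A \<in> \<F>" "B \<in> \<F>" "lift i \<F> A = lift i \<F> B"
  then show "A = B"
    by (cases "i \<in> A"; cases "i \<in> B")
      (auto simp: lift_def insert_absorb insert_ident split: if_splits)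
qed

lemma union_closedD: "union_closed \<F> \<Longrightarrow> S \<in> \<F> \<Longrightarrow> T \<in> \<F> \<Longrightarrow> S \<union> T \<in> \<F>"
  by (simp add: union_closed_def)

text \<open>A union containing \<open>i\<close> needs only one of its two versions in
  \<open>\<F>\<close>, and versions of \<open>S\<close> and \<open>T\<close> in \<open>\<F>\<close>
  unite to one. If \<open>i\<close> is absent, both versions of \<open>S\<close> and of
  \<open>T\<close> lie in \<open>\<F>\<close>, hence both versions of the union.\<close>

lemma union_closed_lift:
  assumes "union_closed \<F>"
  shows "union_closed (lift i \<F> ` \<F>)"
  unfolding union_closed_def
proof (intro ballI)
  fix S T assume S: "S \<in> lift i \<F> ` \<F>" and T: "T \<in> lift i \<F> ` \<F>"
  show "S \<union> T \<in> lift i \<F> ` \<F>"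
  proof (cases "i \<in> S \<union> T")
    case True
    obtain S' where S': "S' \<in> \<F>" "S' = S \<or> S' = S - {i}"
      using S by (auto simp: mem_lift_image split: if_splits)
    obtain T' where T': "T' \<in> \<F>" "T' = T \<or> T' = T - {i}"
      using T by (auto simp: mem_lift_image split: if_splits)
    have "S' \<union> T' = S \<union> T \<or> S' \<union> T' = S \<union> T - {i}" using S'(2) T'(2) by blast
    then have "S \<union> T \<in> \<F> \<or> S \<union> T - {i} \<in> \<F>"
      using union_closedD[OF assms S'(1) T'(1)] by metis
    then show ?thesis unfolding mem_lift_image using True by simp
  next
    case False
    then have "S \<in> \<F>" "insert i S \<in> \<F>" "T \<in> \<F>" using S T by (simp_all add: mem_lift_image)
    then have "S \<union> T \<in> \<F>" "insert i S \<union> T \<in> \<F>" using union_closedD[OF assms] by blast+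
    then show ?thesis unfolding mem_lift_image using False by simp
  qed
qed

text \<open>Tracks a single set while the family evolves alongside, so that the displacement of each
  member remains visible.\<close>

fun compress :: "nat list \<Rightarrow> nat set set \<Rightarrow> nat set \<Rightarrow> nat set" where
  "compress [] \<F> A = A"
| "compress (i # is) \<F> A = compress is (lift i \<F> ` \<F>) (lift i \<F> A)"

lemma compress_image_Cons:
  "compress (i # is) \<F> ` \<F> = compress is (lift i \<F> ` \<F>) ` (lift i \<F> ` \<F>)"
  by (simp add: image_image)

lemma inj_on_compress: "inj_on (compress is \<F>) \<F>"
proof (induction "is" arbitrary: \<F>)
  case (Cons i "is")
  show ?case
    using Cons.IH[of "lift i \<F> ` \<F>"] inj_on_lift[of i \<F>] by (simp add: inj_on_def)
qed (simp add: inj_on_def)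

lemma compress_superset: "A \<subseteq> compress is \<F> A"
proof (induction "is" arbitrary: \<F> A)
  case (Cons i "is")
  have "A \<subseteq> lift i \<F> A" by (auto simp: lift_def)
  then show ?case using Cons.IH[of "lift i \<F> A" "lift i \<F> ` \<F>"] by simp
qed simp

lemma compress_subset: "compress is \<F> A \<subseteq> A \<union> set is"
proof (induction "is" arbitrary: \<F> A)
  case (Cons i "is")
  have "lift i \<F> A \<subseteq> insert i A" by (auto simp: lift_def)
  then show ?case using Cons.IH[of "lift i \<F> ` \<F>" "lift i \<F> A"] by auto
qed simp

lemma lift_up_closed:
  assumes "\<forall>A\<in>\<F>. insert j A \<in> \<F>" "A \<in> lift i \<F> ` \<F>"
  shows "insert j A \<in> lift i \<F> ` \<F>"
proof (cases "j = i")
  case False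
  then have "insert j A - {i} = insert j (A - {i})" by auto
  then show ?thesis
    using assms False by (auto simp: mem_lift_image insert_commute[of i j] split: if_splits)
qed (use assms in \<open>auto simp: mem_lift_image split: if_splits\<close>)

lemma compress_up_closed_preserved:
  "\<forall>A\<in>\<F>. insert j A \<in> \<F> \<Longrightarrow> \<forall>A \<in> compress is \<F> ` \<F>. insert j A \<in> compress is \<F> ` \<F>"
proof (induction "is" arbitrary: \<F>)
  case (Cons i "is")
  show ?case unfolding compress_image_Cons
    by (rule Cons.IH) (use lift_up_closed Cons.prems in blast)
qed simp

text \<open>The lift in direction \<open>j\<close> creates closure under inserting \<open>j\<close>,
  and the later lifts preserve it. One pass over the ground set therefore ends in an up-set.\<close>

lemma compress_up_closed:
  "j \<in> set is \<Longrightarrow> A \<in> compress is \<F> ` \<F> \<Longrightarrow> insert j A \<in> compress is \<F> ` \<F>"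
proof (induction "is" arbitrary: \<F>)
  case (Cons i "is")
  show ?case
  proof (cases "j = i")
    case True
    have "\<forall>A \<in> lift i \<F> ` \<F>. insert i A \<in> lift i \<F> ` \<F>"
      by (metis Diff_insert_absorb insertI1 insert_absorb mem_lift_image)
    then show ?thesis
      using compress_up_closed_preserved Cons.prems unfolding True compress_image_Cons by blast
  next
    case False
    then show ?thesis using Cons unfolding compress_image_Cons by auto
  qed
qed simp

text \<open>The hypothesis \<open>A \<union> C \<in> \<F>\<close> survives each lift of \<open>A\<close>. When the last element of \<open>C\<close> is about to
  be added to \<open>A\<close>, it says that the enlarged set is already present, which forbids the addition.\<close>

lemma compress_not_superset:
  assumes "union_closed \<F>" "A \<in> \<F>" "A \<union> C \<in> \<F>" "\<not> C \<subseteq> A"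
  shows "\<not> C \<subseteq> compress is \<F> A"
  using assms
proof (induction "is" arbitrary: \<F> A)
  case (Cons i "is")
  let ?A = "lift i \<F> A"
  have "?A \<union> C \<in> lift i \<F> ` \<F>"
  proof (cases "insert i A \<in> \<F>")
    case True
    \<comment> \<open>Here \<open>A\<close> stays, but \<open>A \<union> C\<close> might be moved
      away. Uniting it with \<open>insert i A\<close> shows that the place above it is
      occupied.\<close>
    then have "insert i A \<union> (A \<union> C) \<in> \<F>" using union_closedD Cons.prems by blast
    then have "insert i (A \<union> C) \<in> \<F>" by (simp add: Un_assoc[symmetric])
    then show ?thesis using True Cons.prems by (simp add: lift_def mem_lift_image)
  next
    case False
    have "insert i (A \<union> C) - {i} = A \<union> C \<or> insert i (A \<union> C) = A \<union> C" by auto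
    then show ?thesis using False Cons.prems by (auto simp: lift_def mem_lift_image)
  qed
  moreover have "\<not> C \<subseteq> ?A"
  proof
    assume "C \<subseteq> ?A"
    then have "insert i A \<notin> \<F>" "A \<union> C = insert i A"
      using Cons.prems(4) by (auto simp: lift_def split: if_splits)
    then show False using Cons.prems(3) by simp
  qed
  ultimately show ?case
    using Cons.IH[OF union_closed_lift[OF Cons.prems(1)], of ?A] Cons.prems(2) by simp
qed simp

text \<open>A common point \<open>X\<close> gives \<open>B \<subseteq> compress is \<F> A\<close>.
  Since \<open>A \<union> B \<in> \<F>\<close>, the preceding lemma with \<open>C = B\<close> forces
  \<open>B \<subseteq> A\<close>; the converse is symmetric.\<close>

lemma compress_intervals_disjoint:
  assumes "union_closed \<F>" "A \<in> \<F>" "B \<in> \<F>"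
    and "A \<subseteq> X" "X \<subseteq> compress is \<F> A" "B \<subseteq> X" "X \<subseteq> compress is \<F> B"
  shows "A = B"
proof -
  have "B \<subseteq> A" using compress_not_superset[of \<F> A B "is"] union_closedD assms by blast
  moreover have "A \<subseteq> B" using compress_not_superset[of \<F> B A "is"] union_closedD assms by blast
  ultimately show ?thesis by blast
qed

section \<open>Dense union-closed families\<close>

lemma sum_card_Pow: "finite V \<Longrightarrow> 2 * (\<Sum>A\<in>Pow V. card A) = card V * 2 ^ card V"
proof -
  assume V: "finite V"
  have bij: "bij_betw (\<lambda>A. V - A) (Pow V) (Pow V)"
    by (rule bij_betw_byWitness[where f' = "\<lambda>A. V - A"]) auto
  have "2 * (\<Sum>A\<in>Pow V. card A) = (\<Sum>A\<in>Pow V. card A) + (\<Sum>A\<in>Pow V. card (V - A))"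
    using sum.reindex_bij_betw[OF bij, of card] by simp
  also have "\<dots> = (\<Sum>A\<in>Pow V. card V)"
    unfolding sum.distrib[symmetric]
    by (rule sum.cong) (use V in \<open>auto simp: card_Diff_subset card_mono finite_subset\<close>)
  finally show ?thesis using V by (simp add: card_Pow)
qed

lemma dense_union_closed_total_size:
  assumes uc: "union_closed \<F>" and sub: "\<F> \<subseteq> Pow {1..n}" and dense: "2 * 2 ^ n \<le> 3 * card \<F>"
  shows "n * card \<F> \<le> 2 * (\<Sum>A\<in>\<F>. card A)"
proof -
  let ?V = "{1..n}"
  define \<phi> where "\<phi> = compress [1..<Suc n] \<F>"
  define U where "U = \<phi> ` \<F>"
  define D where "D = Pow ?V - U"
  have set: "set [1..<Suc n] = ?V" by auto
  have fin: "finite \<F>" using sub by (rule finite_subset) simp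
  have finA: "finite A" if "A \<in> \<F>" for A using sub that finite_subset[of A ?V] by blast
  have inj: "inj_on \<phi> \<F>" unfolding \<phi>_def by (rule inj_on_compress)
  have \<phi>_sup: "A \<subseteq> \<phi> A" for A unfolding \<phi>_def by (rule compress_superset)
  have \<phi>_sub: "\<phi> A \<subseteq> ?V" if "A \<in> \<F>" for A
    using compress_subset[of "[1..<Suc n]" \<F> A] that sub unfolding \<phi>_def set by blast
  have fin\<phi>: "finite (\<phi> A)" if "A \<in> \<F>" for A using \<phi>_sub[OF that] finite_subset by blast
  have U_sub: "U \<subseteq> Pow ?V" unfolding U_def using \<phi>_sub by blast
  have card_U: "card U = card \<F>" unfolding U_def using inj by (rule card_image)
  have card_D: "card D + card \<F> = 2 ^ n"
    unfolding D_def using card_Diff_subset[of U "Pow ?V"] U_sub card_mono[OF _ U_sub] card_U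
    by (simp add: card_Pow finite_subset[OF U_sub])
  have U_insert: "insert j A \<in> U" if "A \<in> U" "j \<in> ?V" for A j
    using compress_up_closed[of j "[1..<Suc n]" A \<F>] that unfolding U_def \<phi>_def set by blast
  have U_up: "A \<union> B \<in> U" if "finite B" "A \<in> U" "B \<subseteq> ?V" for A B
    using that by (induction B rule: finite_induct) (auto intro: U_insert)
  have D_down: "B \<in> D" if "A \<in> D" "B \<subseteq> A" for A B
  proof -
    have "A \<subseteq> ?V" "A \<notin> U" using that by (auto simp: D_def)
    moreover have "B \<union> A = A" using that by blast
    ultimately show ?thesis using U_up[of A B] that finite_subset[of A ?V] by (auto simp: D_def)
  qed
  \<comment> \<open>The term \<open>2 * card D\<close> is the surplus that will pay for the
    enlargement of the sets, at most \<open>card D\<close> before doubling.\<close>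
  have "2 * (\<Sum>A\<in>D. card A) + 2 * card D \<le> n * card D"
  proof -
    have "(\<Sum>A\<in>D. card A) \<le> digit_total (card D)"
      by (rule down_set_total_size[OF _ _ D_down, of ?V]) (auto simp: D_def)
    moreover have "3 * card D \<le> 2 ^ n" using dense card_D by linarith
    ultimately show ?thesis using digit_total_le_third[of "card D" n] by linarith
  qed
  \<comment> \<open>The whole cube is balanced around \<open>n / 2\<close>, so the deficit of
    \<open>D\<close> reappears as an excess of \<open>U\<close>.\<close>
  moreover have "2 * (\<Sum>A\<in>U. card A) + 2 * (\<Sum>A\<in>D. card A) = n * (card \<F> + card D)"
  proof -
    have "(\<Sum>A\<in>Pow ?V. card A) = (\<Sum>A\<in>D. card A) + (\<Sum>A\<in>U. card A)"
      unfolding D_def by (rule sum.subset_diff[OF U_sub]) simp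
    moreover have "2 * (\<Sum>A\<in>Pow ?V. card A) = n * (card \<F> + card D)"
      using sum_card_Pow[of ?V] card_D by (simp only: add.commute) simp
    ultimately show ?thesis by linarith
  qed
  moreover have "(\<Sum>A\<in>U. card A) = (\<Sum>A\<in>\<F>. card A) + (\<Sum>A\<in>\<F>. card (\<phi> A - A))"
  proof -
    have "(\<Sum>A\<in>U. card A) = (\<Sum>A\<in>\<F>. card (\<phi> A))" unfolding U_def using inj by (simp add: sum.reindex)
    also have "\<dots> = (\<Sum>A\<in>\<F>. card A + card (\<phi> A - A))"
      by (rule sum.cong) (use \<phi>_sup finA fin\<phi> in \<open>simp_all add: card_Diff_subset card_mono\<close>)
    finally show ?thesis by (simp add: sum.distrib)
  qed
  moreover have "(\<Sum>A\<in>\<F>. card (\<phi> A - A)) \<le> card D"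
  proof -
    let ?P = "SIGMA A:\<F>. \<phi> A - A"
    \<comment> \<open>Each added element \<open>i\<close> of \<open>A\<close> is charged to
      \<open>\<phi> A - {i}\<close>, which still lies in the interval from \<open>A\<close> to
      \<open>\<phi> A\<close>. Disjointness of the intervals recovers \<open>A\<close>, and then
      \<open>i\<close>.\<close>
    let ?h = "\<lambda>(A, i). \<phi> A - {i}"
    have "inj_on ?h ?P"
    proof (rule inj_onI, clarify)
      fix A i B j
      assume A: "A \<in> \<F>" "i \<in> \<phi> A" "i \<notin> A" and B: "B \<in> \<F>" "j \<in> \<phi> B" "j \<notin> B"
        and eq: "\<phi> A - {i} = \<phi> B - {j}"
      have "A \<subseteq> \<phi> A - {i}" "B \<subseteq> \<phi> A - {i}" "\<phi> A - {i} \<subseteq> \<phi> B"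
        using \<phi>_sup[of A] \<phi>_sup[of B] A B eq by auto
      then have "A = B"
        using compress_intervals_disjoint[OF uc A(1) B(1)] unfolding \<phi>_def by blast
      then show "A = B \<and> i = j" using eq A B by blast
    qed
    moreover have "?h ` ?P \<subseteq> D"
    proof clarify
      fix A i assume A: "A \<in> \<F>" "i \<in> \<phi> A" "i \<notin> A"
      have "\<phi> A - {i} \<notin> U"
      proof
        assume "\<phi> A - {i} \<in> U"
        \<comment> \<open>The point \<open>\<phi> B\<close> would lie in the intervals of both
          \<open>A\<close> and \<open>B\<close>, so \<open>A = B\<close>, although \<open>i\<close>
          is missing from \<open>\<phi> B\<close>.\<close>
        then obtain B where B: "B \<in> \<F>" "\<phi> A - {i} = \<phi> B" by (auto simp: U_def)
        have "A \<subseteq> \<phi> B" "\<phi> B \<subseteq> \<phi> A" using \<phi>_sup[of A] A B by auto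
        then have "A = B"
          using compress_intervals_disjoint[OF uc A(1) B(1)] \<phi>_sup[of B] unfolding \<phi>_def by blast
        then show False using B A by blast
      qed
      then show "\<phi> A - {i} \<in> D" using \<phi>_sub[OF A(1)] by (auto simp: D_def)
    qed
    ultimately have "card ?P \<le> card D" by (rule card_inj_on_le) (simp add: D_def)
    then show ?thesis using fin fin\<phi> by simp
  qed
  ultimately show ?thesis by (simp add: algebra_simps)
qed

section \<open>Double counting and averaging over the ground set\<close>

lemma sum_occurrences:
  assumes "\<F> \<subseteq> Pow {1..n}"
  shows "(\<Sum>e\<in>{1..n}. occurrences \<F> e) = (\<Sum>A\<in>\<F>. card A)"
proof -
  have fin: "finite \<F>" using assms by (rule finite_subset) simp
  have "(\<Sum>e\<in>{1..n}. occurrences \<F> e) = (\<Sum>A\<in>\<F>. card {e \<in> {1..n}. e \<in> A})"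
    unfolding occurrences_def using fin by (intro sum_multicount_gen) auto
  also have "\<dots> = (\<Sum>A\<in>\<F>. card A)"
  proof (rule sum.cong)
    fix A assume "A \<in> \<F>"
    then have "{e \<in> {1..n}. e \<in> A} = A" using assms by blast
    then show "card {e \<in> {1..n}. e \<in> A} = card A" by simp
  qed simp
  finally show ?thesis .
qed

lemma dense_union_closed_max_occurrences:
  assumes "union_closed \<F>" "family_on n \<F>" "2 * 2 ^ n \<le> 3 * card \<F>" "n \<ge> 1"
  shows "card \<F> \<le> 2 * max_occurrences n \<F>"
proof -
  have sub: "\<F> \<subseteq> Pow {1..n}" using assms(2) by (simp add: family_on_def)
  have "(\<Sum>e\<in>{1..n}. occurrences \<F> e) \<le> (\<Sum>e\<in>{1..n}. max_occurrences n \<F>)"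
    by (rule sum_mono) (simp add: max_occurrences_def)
  then have "(\<Sum>A\<in>\<F>. card A) \<le> n * max_occurrences n \<F>"
    unfolding sum_occurrences[OF sub] by simp
  then have "n * card \<F> \<le> n * (2 * max_occurrences n \<F>)"
    using dense_union_closed_total_size[OF assms(1) sub assms(3)] by linarith
  then show ?thesis using assms(4) by simp
qed

section \<open>Change of the ground set\<close>

text \<open>Starting from the power set, inclusion-minimal members are deleted one at a time: a
  minimal member is not a union of other members. This makes the minimum \<open>uc_g\<close> range
  over a nonempty set.\<close>

lemma union_closed_exists:
  assumes "m \<le> 2 ^ n"
  shows "\<exists>\<F>. family_on n \<F> \<and> union_closed \<F> \<and> card \<F> = m"
  using assms
proof (induction m rule: inc_induct)
  case base
  have "union_closed (Pow {1..n})" by (auto simp: union_closed_def)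
  then show ?case by (intro exI[of _ "Pow {1..n}"]) (simp add: family_on_def card_Pow)
next
  case (step m)
  then obtain \<F> where F: "family_on n \<F>" "union_closed \<F>" "card \<F> = Suc m" by blast
  then have "finite \<F>" "\<F> \<noteq> {}" by (auto intro: card_ge_0_finite)
  then obtain A where A: "A \<in> \<F>" "\<forall>B\<in>\<F>. B \<subseteq> A \<longrightarrow> A = B"
    using finite_has_minimal by metis
  have "union_closed (\<F> - {A})"
    using F(2) A unfolding union_closed_def by blast
  then show ?case
    using F A by (intro exI[of _ "\<F> - {A}"]) (auto simp: family_on_def)
qed

lemma finite_max_occurrences_set:
  "finite {max_occurrences n \<F> | \<F>. family_on n \<F> \<and> P \<F>}"
  by (rule finite_subset[of _ "max_occurrences n ` Pow (Pow {1..n})"]) (auto simp: family_on_def)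

lemma uc_g_le:
  "family_on n \<F> \<Longrightarrow> union_closed \<F> \<Longrightarrow> uc_g n (card \<F>) \<le> max_occurrences n \<F>"
  unfolding uc_g_def by (rule Min_le[OF finite_max_occurrences_set]) blast

lemma uc_g_attained:
  assumes "m \<le> 2 ^ n"
  obtains \<F> where "family_on n \<F>" "union_closed \<F>" "card \<F> = m" "uc_g n m = max_occurrences n \<F>"
proof -
  have "uc_g n m \<in> {max_occurrences n \<F> | \<F>. family_on n \<F> \<and> union_closed \<F> \<and> card \<F> = m}"
    unfolding uc_g_def
    by (rule Min_in[OF finite_max_occurrences_set]) (use union_closed_exists[OF assms] in blast)
  then show thesis using that by blast
qed

theorem theorem2p5:
  fixes m n :: nat and \<F> :: "nat set set"
  assumes f_stable: "\<And>a k :: nat. a \<ge> 1 \<Longrightarrow> k \<ge> 1 \<Longrightarrow> int k \<ge> \<lceil>log 2 (real a)\<rceil> + 1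
                       \<Longrightarrow> uc_f k a = uc_f (k + 1) a"
    and g_stable: "\<And>l k :: nat. l \<ge> 2 \<Longrightarrow> k \<ge> 1 \<Longrightarrow> int k \<ge> \<lceil>log 2 (real l)\<rceil>
                       \<Longrightarrow> uc_g k l = uc_g (k + 1) l"
    and m_pos: "m \<ge> 1"
    and m_range: "\<exists>i::nat. i \<ge> 1 \<and> 2 / 3 * 2 ^ i \<le> real m \<and> real m \<le> 2 ^ i"
    and fam: "family_on n \<F>"
    and uc: "union_closed \<F>"
    and nonempty: "\<F> \<noteq> {}"
    and card: "card \<F> = m"
  shows "real (max_occurrences n \<F>) \<ge> real m / 2"
proof -
  obtain i :: nat where i: "i \<ge> 1" "2 / 3 * 2 ^ i \<le> real m" "real m \<le> 2 ^ i" using m_range by blast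
  have "real (2 * 2 ^ i) \<le> real (3 * m)" using i(2) by simp
  then have dense: "2 * 2 ^ i \<le> 3 * m" by (rule of_nat_le_iff[THEN iffD1])
  have m_le: "m \<le> 2 ^ i" using i(3) by (metis of_nat_le_iff of_nat_numeral of_nat_power)
  have "(2::nat) ^ 1 \<le> 2 ^ i" using i(1) by (intro power_increasing) auto
  then have m2: "m \<ge> 2" using dense by simp
  have "card \<F> \<le> card (Pow {1..n})" using fam by (intro card_mono) (auto simp: family_on_def)
  then have "m \<le> 2 ^ n" using card by (simp add: card_Pow)
  \<comment> \<open>Density gives \<open>m > 2 ^ (i - 1)\<close>, so a ground set smaller than
    \<open>{1..i}\<close> has too few subsets. Hence stability only ever has to lead from
    \<open>n\<close> down to \<open>i\<close>.\<close>
  have "i \<le> n"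
  proof (rule ccontr)
    assume "\<not> i \<le> n"
    then have "(2::nat) ^ Suc n \<le> 2 ^ i" by (intro power_increasing) auto
    then have "2 * 2 ^ n \<le> (2::nat) ^ i" by simp
    then have "4 * 2 ^ n \<le> 3 * m" using dense by linarith
    then show False using \<open>m \<le> 2 ^ n\<close> m2 by linarith
  qed
  have "log 2 (real m) \<le> log 2 (2 ^ i)" using i(3) m2 by (subst log_le_cancel_iff) auto
  then have "\<lceil>log 2 (real m)\<rceil> \<le> int i" by (simp add: ceiling_le_iff)
  then have stable: "uc_g k m = uc_g (k + 1) m" if "i \<le> k" for k
    using g_stable[of m k] m2 i(1) that by linarith
  have "uc_g n m = uc_g i m"
    using \<open>i \<le> n\<close>
  proof (induction n rule: dec_induct)
    case (step k)
    then show ?case using stable[of k] by simp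
  qed simp
  \<comment> \<open>A minimiser on \<open>{1..i}\<close> has density at least 2/3 there, so
    averaging applies to it, and the equality of the two \<open>uc_g\<close> values transfers the
    bound to \<open>\<F>\<close>.\<close>
  moreover obtain \<G> where "family_on i \<G>" "union_closed \<G>" "card \<G> = m"
    "uc_g i m = max_occurrences i \<G>" using uc_g_attained[OF m_le] .
  ultimately have "m \<le> 2 * max_occurrences n \<F>"
    using dense_union_closed_max_occurrences[of \<G> i] dense i(1) uc_g_le[OF fam uc] card by simp
  then show ?thesis by linarith
qed

end
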